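(* Every medial rack is nilpotent of length at most $2$.
   Context: A left quasigroup is a nonempty set $Q$ with two binary operations $*,\backslash$ satisfying $x\backslash(x*y)=y=x*(x\backslash y)$. A rack is a left quasigroup satisfying $x*(y*z)=(x*y)*(x*z)$. It is medial if $(x*y)*(u*v)=(x*u)*(y*v)$ for all $x,y,u,v$. Congruences and terms are taken with respect to both $*$ and $\backslash$. For congruences $\alpha,\beta,\delta$ of an algebraic structure $A$, $C(\alpha,\beta;\delta)$ means: for every $n\ge0$, every $(n+1)$-ary term operation $t$, every $a\,\alpha\,b$ and all $u_i\,\beta\,v_i$ ($i=1,\dots,n$), $t(a,u_1,\dots,u_n)\,\delta\,t(a,v_1,\dots,v_n)$ implies $t(b,u_1,\dots,u_n)\,\delta\,t(b,v_1,\dots,v_n)$. With $0_A$ the equality relation and $1_A=A\times A$, a congruence $\alpha$ is central if $C(\alpha,1_A;0_A)$. $A$ is nilpotent if there is a chain of congruences $0_A=\alpha_0\le\alpha_1\le\dots\le\alpha_n=1_A$ such that $\alpha_{i+1}/\alpha_i$ is a central congruence of $A/\alpha_i$ for all $i$; the length of nilpotence is the smallest such $n$. *)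

theory Defs
  imports Main
begin

record 'a binary_algebra =
  carrier :: "'a set"
  mult :: "'a \<Rightarrow> 'a \<Rightarrow> 'a"  (infixl \<open>\<star>\<index>\<close> 70)
  ldiv :: "'a \<Rightarrow> 'a \<Rightarrow> 'a"  (infixl \<open>\<setminus>\<index>\<close> 70)

locale left_quasigroup =
  fixes Q :: "'a binary_algebra" (structure)
  assumes nonempty: "carrier Q \<noteq> {}"
    and mult_closed: "\<lbrakk>x \<in> carrier Q; y \<in> carrier Q\<rbrakk> \<Longrightarrow> x \<star> y \<in> carrier Q"
    and ldiv_closed: "\<lbrakk>x \<in> carrier Q; y \<in> carrier Q\<rbrakk> \<Longrightarrow> x \<setminus> y \<in> carrier Q"
    and ldiv_mult: "\<lbrakk>x \<in> carrier Q; y \<in> carrier Q\<rbrakk> \<Longrightarrow> x \<setminus> (x \<star> y) = y"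
    and mult_ldiv: "\<lbrakk>x \<in> carrier Q; y \<in> carrier Q\<rbrakk> \<Longrightarrow> x \<star> (x \<setminus> y) = y"

locale rack = left_quasigroup +
  assumes left_distrib:
    "\<lbrakk>x \<in> carrier Q; y \<in> carrier Q; z \<in> carrier Q\<rbrakk>
      \<Longrightarrow> x \<star> (y \<star> z) = (x \<star> y) \<star> (x \<star> z)"

locale medial_rack = rack +
  assumes medial:
    "\<lbrakk>x \<in> carrier Q; y \<in> carrier Q; u \<in> carrier Q; v \<in> carrier Q\<rbrakk>
      \<Longrightarrow> (x \<star> y) \<star> (u \<star> v) = (x \<star> u) \<star> (y \<star> v)"


definition congruence :: "'a binary_algebra \<Rightarrow> ('a \<times> 'a) set \<Rightarrow> bool" where
  "congruence A \<theta> \<longleftrightarrow> equiv (carrier A) \<theta> \<and>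
     (\<forall>x x' y y'. (x, x') \<in> \<theta> \<longrightarrow> (y, y') \<in> \<theta> \<longrightarrow>
        (x \<star>\<^bsub>A\<^esub> y, x' \<star>\<^bsub>A\<^esub> y') \<in> \<theta> \<and> (x \<setminus>\<^bsub>A\<^esub> y, x' \<setminus>\<^bsub>A\<^esub> y') \<in> \<theta>)"

definition zero_cong :: "'a binary_algebra \<Rightarrow> ('a \<times> 'a) set" where
  "zero_cong A = Id_on (carrier A)"

definition one_cong :: "'a binary_algebra \<Rightarrow> ('a \<times> 'a) set" where
  "one_cong A = carrier A \<times> carrier A"

text \<open>For a congruence, the union in each operation is a single class; see the lemmas below.\<close>

definition quot_alg :: "'a binary_algebra \<Rightarrow> ('a \<times> 'a) set \<Rightarrow> 'a set binary_algebra" where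
  "quot_alg A \<theta> = \<lparr> carrier = carrier A // \<theta>,
     mult = (\<lambda>X Y. \<Union>x\<in>X. \<Union>y\<in>Y. \<theta> `` {x \<star>\<^bsub>A\<^esub> y}),
     ldiv = (\<lambda>X Y. \<Union>x\<in>X. \<Union>y\<in>Y. \<theta> `` {x \<setminus>\<^bsub>A\<^esub> y}) \<rparr>"

lemma quot_alg_mult:
  assumes "congruence A \<theta>" "x \<in> carrier A" "y \<in> carrier A"
  shows "\<theta> `` {x} \<star>\<^bsub>quot_alg A \<theta>\<^esub> \<theta> `` {y} = \<theta> `` {x \<star>\<^bsub>A\<^esub> y}"
proof -
  have e: "equiv (carrier A) \<theta>" using assms(1) by (simp add: congruence_def)
  have "congruent2 \<theta> \<theta> (\<lambda>x y. \<theta> `` {x \<star>\<^bsub>A\<^esub> y})"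
    using assms(1) unfolding congruence_def
    by (intro congruent2I' equiv_class_eq[OF e]) blast
  from UN_equiv_class2[OF e e this assms(2,3)] show ?thesis by (simp add: quot_alg_def)
qed

lemma quot_alg_ldiv:
  assumes "congruence A \<theta>" "x \<in> carrier A" "y \<in> carrier A"
  shows "\<theta> `` {x} \<setminus>\<^bsub>quot_alg A \<theta>\<^esub> \<theta> `` {y} = \<theta> `` {x \<setminus>\<^bsub>A\<^esub> y}"
proof -
  have e: "equiv (carrier A) \<theta>" using assms(1) by (simp add: congruence_def)
  have "congruent2 \<theta> \<theta> (\<lambda>x y. \<theta> `` {x \<setminus>\<^bsub>A\<^esub> y})"
    using assms(1) unfolding congruence_def
    by (intro congruent2I' equiv_class_eq[OF e]) blast
  from UN_equiv_class2[OF e e this assms(2,3)] show ?thesis by (simp add: quot_alg_def)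
qed

text \<open>The congruence \<open>\<alpha>/\<theta>\<close> of \<open>A/\<theta>\<close>, for \<open>\<theta> \<subseteq> \<alpha>\<close>.\<close>

definition quot_cong :: "('a \<times> 'a) set \<Rightarrow> ('a \<times> 'a) set \<Rightarrow> ('a set \<times> 'a set) set" where
  "quot_cong \<alpha> \<theta> = {(\<theta> `` {a}, \<theta> `` {b}) | a b. (a, b) \<in> \<alpha>}"


datatype lq_term = Var nat | Mult lq_term lq_term | LDiv lq_term lq_term

fun term_vars :: "lq_term \<Rightarrow> nat set" where
  "term_vars (Var i) = {i}"
| "term_vars (Mult s t) = term_vars s \<union> term_vars t"
| "term_vars (LDiv s t) = term_vars s \<union> term_vars t"

fun term_op :: "'a binary_algebra \<Rightarrow> lq_term \<Rightarrow> (nat \<Rightarrow> 'a) \<Rightarrow> 'a" where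
  "term_op A (Var i) \<rho> = \<rho> i"
| "term_op A (Mult s t) \<rho> = term_op A s \<rho> \<star>\<^bsub>A\<^esub> term_op A t \<rho>"
| "term_op A (LDiv s t) \<rho> = term_op A s \<rho> \<setminus>\<^bsub>A\<^esub> term_op A t \<rho>"

text \<open>
  The relation \<open>C(\<alpha>, \<beta>; \<delta>)\<close>. An \<open>(n+1)\<close>-ary term is a term in the variables \<open>0, \<dots>, n\<close>;
  the tuple \<open>(a, u\<^sub>1, \<dots>, u\<^sub>n)\<close> is the assignment \<open>u(0 := a)\<close>, whose values beyond
  \<open>n\<close> are irrelevant.
\<close>

definition centralizes ::
  "'a binary_algebra \<Rightarrow> ('a \<times> 'a) set \<Rightarrow> ('a \<times> 'a) set \<Rightarrow> ('a \<times> 'a) set \<Rightarrow> bool" where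
  "centralizes A \<alpha> \<beta> \<delta> \<longleftrightarrow>
     (\<forall>n t a b u v.
        term_vars t \<subseteq> {0..n} \<longrightarrow> (a, b) \<in> \<alpha> \<longrightarrow> (\<forall>i\<in>{1..n}. (u i, v i) \<in> \<beta>) \<longrightarrow>
        (term_op A t (u(0 := a)), term_op A t (v(0 := a))) \<in> \<delta> \<longrightarrow>
        (term_op A t (u(0 := b)), term_op A t (v(0 := b))) \<in> \<delta>)"

definition central :: "'a binary_algebra \<Rightarrow> ('a \<times> 'a) set \<Rightarrow> bool" where
  "central A \<alpha> \<longleftrightarrow> congruence A \<alpha> \<and> centralizes A \<alpha> (one_cong A) (zero_cong A)"

definition central_chain :: "'a binary_algebra \<Rightarrow> nat \<Rightarrow> (nat \<Rightarrow> ('a \<times> 'a) set) \<Rightarrow> bool" where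
  "central_chain A n \<alpha> \<longleftrightarrow>
     (\<forall>i\<le>n. congruence A (\<alpha> i)) \<and> \<alpha> 0 = zero_cong A \<and> \<alpha> n = one_cong A \<and>
     (\<forall>i<n. \<alpha> i \<subseteq> \<alpha> (Suc i) \<and>
        central (quot_alg A (\<alpha> i)) (quot_cong (\<alpha> (Suc i)) (\<alpha> i)))"

definition nilpotent :: "'a binary_algebra \<Rightarrow> bool" where
  "nilpotent A \<longleftrightarrow> (\<exists>n \<alpha>. central_chain A n \<alpha>)"

text \<open>Only meaningful when \<open>A\<close> is nilpotent.\<close>

definition nilpotence_length :: "'a binary_algebra \<Rightarrow> nat" where
  "nilpotence_length A = (LEAST n. \<exists>\<alpha>. central_chain A n \<alpha>)"

end

theory Submission
  imports Defs
begin

text \<open>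
  Write \<open>L\<^sub>x\<close> for the left translation by \<open>x\<close>. The displacement group of a rack is generated by
  the permutations \<open>L\<^sub>x L\<^sub>z\<^sup>-\<^sup>1\<close>; it consists of automorphisms and is normalized by all left
  translations. In a medial rack it is abelian, and the chain is \<open>0 \<le> \<alpha> \<le> 1\<close>, where the
  classes of \<open>\<alpha>\<close> are the orbits of the displacement group.

  Upper step: modulo \<open>\<alpha>\<close> all left translations coincide, so there \<open>x \<star> y\<close> is a permutation
  applied to \<open>y\<close>. A term operation therefore depends on its rightmost variable only, and is
  injective in it. Such an algebra is abelian.

  Lower step: the displacement group is abelian, and any two left translations differ by a
  displacement. Hence all left translations act in the same way on displacements by
  conjugation. It follows by induction on a term \<open>t\<close> that replacing \<open>a\<close> by \<open>g a\<close>, for a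
  displacement \<open>g\<close>, multiplies the value \<open>t(a, u)\<close> by a displacement that depends on \<open>t\<close> and
  \<open>g\<close> but not on the parameters \<open>u\<close>. So \<open>t(a, u) = t(a, v)\<close> implies
  \<open>t(g a, u) = t(g a, v)\<close>, which says that \<open>\<alpha>\<close> is central.

  Both steps are proved in the rack itself, as \<open>C(\<alpha>, 1; 0)\<close> and \<open>C(1, 1; \<alpha>)\<close>, and carried over
  to the quotients by the fact that \<open>C(\<alpha>, 1; \<theta>)\<close> makes \<open>\<alpha>/\<theta>\<close> central modulo \<open>\<theta>\<close>.
\<close>

section \<open>Centrality in quotients\<close>

lemma congruence_subset: "congruence A \<theta> \<Longrightarrow> \<theta> \<subseteq> carrier A \<times> carrier A"
  by (auto simp: congruence_def equiv_def)

lemma congruence_refl: "congruence A \<theta> \<Longrightarrow> x \<in> carrier A \<Longrightarrow> (x, x) \<in> \<theta>"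
  by (auto simp: congruence_def equiv_def refl_on_def)

lemma congruence_sym: "congruence A \<theta> \<Longrightarrow> (x, y) \<in> \<theta> \<Longrightarrow> (y, x) \<in> \<theta>"
  by (auto simp: congruence_def equiv_def dest: symD)

lemma congruence_trans: "congruence A \<theta> \<Longrightarrow> (x, y) \<in> \<theta> \<Longrightarrow> (y, z) \<in> \<theta> \<Longrightarrow> (x, z) \<in> \<theta>"
  by (auto simp: congruence_def equiv_def dest: transD)

lemma congruence_mult:
  "congruence A \<theta> \<Longrightarrow> (x, x') \<in> \<theta> \<Longrightarrow> (y, y') \<in> \<theta> \<Longrightarrow> (x \<star>\<^bsub>A\<^esub> y, x' \<star>\<^bsub>A\<^esub> y') \<in> \<theta>"
  by (auto simp: congruence_def)

lemma congruence_ldiv: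
  "congruence A \<theta> \<Longrightarrow> (x, x') \<in> \<theta> \<Longrightarrow> (y, y') \<in> \<theta> \<Longrightarrow> (x \<setminus>\<^bsub>A\<^esub> y, x' \<setminus>\<^bsub>A\<^esub> y') \<in> \<theta>"
  by (auto simp: congruence_def)

text \<open>The existence of a congruence forces the carrier to be closed under the operations.\<close>

lemma congruence_mult_closed:
  assumes "congruence A \<theta>" "x \<in> carrier A" "y \<in> carrier A"
  shows "x \<star>\<^bsub>A\<^esub> y \<in> carrier A"
  using congruence_mult[OF assms(1) congruence_refl[OF assms(1,2)] congruence_refl[OF assms(1,3)]]
    congruence_subset[OF assms(1)] by blast

lemma congruence_ldiv_closed:
  assumes "congruence A \<theta>" "x \<in> carrier A" "y \<in> carrier A"
  shows "x \<setminus>\<^bsub>A\<^esub> y \<in> carrier A"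
  using congruence_ldiv[OF assms(1) congruence_refl[OF assms(1,2)] congruence_refl[OF assms(1,3)]]
    congruence_subset[OF assms(1)] by blast

lemma congruence_class_eq_iff:
  assumes "congruence A \<theta>" "x \<in> carrier A" "y \<in> carrier A"
  shows "\<theta> `` {x} = \<theta> `` {y} \<longleftrightarrow> (x, y) \<in> \<theta>"
  using assms unfolding congruence_def by (metis eq_equiv_class_iff)

lemma term_op_closed:
  assumes "congruence A \<theta>" "\<And>i. i \<in> term_vars t \<Longrightarrow> \<rho> i \<in> carrier A"
  shows "term_op A t \<rho> \<in> carrier A"
  using assms(2)
  by (induction t)
    (simp_all add: congruence_mult_closed[OF assms(1)] congruence_ldiv_closed[OF assms(1)])

lemma term_op_quot_alg:
  assumes "congruence A \<theta>" "\<And>i. i \<in> term_vars t \<Longrightarrow> \<rho> i \<in> carrier A"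
    "\<And>i. i \<in> term_vars t \<Longrightarrow> R i = \<theta> `` {\<rho> i}"
  shows "term_op (quot_alg A \<theta>) t R = \<theta> `` {term_op A t \<rho>}"
  using assms(2,3)
proof (induction t)
  case (Mult s t)
  have "term_op A s \<rho> \<in> carrier A" "term_op A t \<rho> \<in> carrier A"
    using term_op_closed[OF assms(1)] Mult.prems(1) by auto
  then show ?case using Mult quot_alg_mult[OF assms(1)] by simp
next
  case (LDiv s t)
  have "term_op A s \<rho> \<in> carrier A" "term_op A t \<rho> \<in> carrier A"
    using term_op_closed[OF assms(1)] LDiv.prems(1) by auto
  then show ?case using LDiv quot_alg_ldiv[OF assms(1)] by simp
qed simp

lemma congruence_quot_cong:
  assumes \<theta>: "congruence A \<theta>" and \<alpha>: "congruence A \<alpha>" and sub: "\<theta> \<subseteq> \<alpha>"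
  shows "congruence (quot_alg A \<theta>) (quot_cong \<alpha> \<theta>)"
proof -
  note mem = subsetD[OF congruence_subset[OF \<alpha>]]
  have "equiv (carrier A // \<theta>) (quot_cong \<alpha> \<theta>)"
  proof (rule equivI)
    show "quot_cong \<alpha> \<theta> \<subseteq> (carrier A // \<theta>) \<times> (carrier A // \<theta>)"
      using mem unfolding quot_cong_def by (blast intro: quotientI)
    show "refl_on (carrier A // \<theta>) (quot_cong \<alpha> \<theta>)"
    proof (rule refl_onI)
      fix X assume "X \<in> carrier A // \<theta>"
      then obtain x where "x \<in> carrier A" "X = \<theta> `` {x}" by (rule quotientE)
      then show "(X, X) \<in> quot_cong \<alpha> \<theta>"
        using congruence_refl[OF \<alpha>] unfolding quot_cong_def by blast
    qed
    show "sym (quot_cong \<alpha> \<theta>)"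
      using congruence_sym[OF \<alpha>] unfolding sym_def quot_cong_def by blast
    show "trans (quot_cong \<alpha> \<theta>)"
    proof (rule transI)
      fix X Y Z assume "(X, Y) \<in> quot_cong \<alpha> \<theta>" "(Y, Z) \<in> quot_cong \<alpha> \<theta>"
      then obtain a b b' c where *: "X = \<theta> `` {a}" "Y = \<theta> `` {b}" "(a, b) \<in> \<alpha>"
        "Y = \<theta> `` {b'}" "Z = \<theta> `` {c}" "(b', c) \<in> \<alpha>"
        by (auto simp: quot_cong_def)
      then have "(b, b') \<in> \<alpha>"
        using congruence_class_eq_iff[OF \<theta>, of b b'] sub mem by blast
      with * have "(a, c) \<in> \<alpha>" by (blast intro: congruence_trans[OF \<alpha>])
      with * show "(X, Z) \<in> quot_cong \<alpha> \<theta>" by (auto simp: quot_cong_def)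
    qed
  qed
  moreover have "(X \<star>\<^bsub>quot_alg A \<theta>\<^esub> Y, X' \<star>\<^bsub>quot_alg A \<theta>\<^esub> Y') \<in> quot_cong \<alpha> \<theta> \<and>
      (X \<setminus>\<^bsub>quot_alg A \<theta>\<^esub> Y, X' \<setminus>\<^bsub>quot_alg A \<theta>\<^esub> Y') \<in> quot_cong \<alpha> \<theta>"
    if "(X, X') \<in> quot_cong \<alpha> \<theta>" "(Y, Y') \<in> quot_cong \<alpha> \<theta>" for X X' Y Y'
  proof -
    obtain x x' where X: "X = \<theta> `` {x}" "X' = \<theta> `` {x'}" "(x, x') \<in> \<alpha>"
      using \<open>(X, X') \<in> quot_cong \<alpha> \<theta>\<close> by (auto simp: quot_cong_def)
    obtain y y' where Y: "Y = \<theta> `` {y}" "Y' = \<theta> `` {y'}" "(y, y') \<in> \<alpha>"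
      using \<open>(Y, Y') \<in> quot_cong \<alpha> \<theta>\<close> by (auto simp: quot_cong_def)
    have "x \<in> carrier A" "x' \<in> carrier A" "y \<in> carrier A" "y' \<in> carrier A"
      using X(3) Y(3) mem by auto
    then show ?thesis
      using X Y congruence_mult[OF \<alpha> X(3) Y(3)] congruence_ldiv[OF \<alpha> X(3) Y(3)]
      by (auto simp: quot_alg_mult[OF \<theta>] quot_alg_ldiv[OF \<theta>] quot_cong_def)
  qed
  ultimately show ?thesis by (auto simp: congruence_def quot_alg_def)
qed

text \<open>
  Term operations of the quotient are computed on representatives, so each instance of the
  centrality condition modulo \<open>\<theta>\<close> is an instance of \<open>C(\<alpha>, 1; \<theta>)\<close> for chosen representatives.
\<close>

lemma central_quot_cong:
  assumes \<theta>: "congruence A \<theta>" and \<alpha>: "congruence A \<alpha>" and sub: "\<theta> \<subseteq> \<alpha>"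
    and cent: "centralizes A \<alpha> (one_cong A) \<theta>"
  shows "central (quot_alg A \<theta>) (quot_cong \<alpha> \<theta>)"
proof -
  have "centralizes (quot_alg A \<theta>) (quot_cong \<alpha> \<theta>)
      (one_cong (quot_alg A \<theta>)) (zero_cong (quot_alg A \<theta>))"
    unfolding centralizes_def
  proof (intro allI impI)
    fix n t X Y U V
    assume vars: "term_vars t \<subseteq> {0..n}"
      and XY: "(X, Y) \<in> quot_cong \<alpha> \<theta>"
      and UV: "\<forall>i\<in>{1..n}. (U i, V i) \<in> one_cong (quot_alg A \<theta>)"
      and eq: "(term_op (quot_alg A \<theta>) t (U(0 := X)), term_op (quot_alg A \<theta>) t (V(0 := X)))
        \<in> zero_cong (quot_alg A \<theta>)"
    from XY obtain a b where X: "X = \<theta> `` {a}" and Y: "Y = \<theta> `` {b}" and ab: "(a, b) \<in> \<alpha>"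
      by (auto simp: quot_cong_def)
    then have mem: "a \<in> carrier A" "b \<in> carrier A" using congruence_subset[OF \<alpha>] by auto
    have "\<forall>i\<in>{1..n}. (\<exists>u. u \<in> carrier A \<and> U i = \<theta> `` {u}) \<and> (\<exists>v. v \<in> carrier A \<and> V i = \<theta> `` {v})"
      using UV by (auto simp: one_cong_def quot_alg_def elim!: quotientE)
    then obtain u v where uv: "\<And>i. i \<in> {1..n} \<Longrightarrow> u i \<in> carrier A \<and> U i = \<theta> `` {u i}"
        "\<And>i. i \<in> {1..n} \<Longrightarrow> v i \<in> carrier A \<and> V i = \<theta> `` {v i}"
      by metis
    have *: "term_op (quot_alg A \<theta>) t (R(0 := \<theta> `` {c})) = \<theta> `` {term_op A t (r(0 := c))} \<and>
        term_op A t (r(0 := c)) \<in> carrier A"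
      if "c \<in> carrier A" "\<And>i. i \<in> {1..n} \<Longrightarrow> r i \<in> carrier A \<and> R i = \<theta> `` {r i}" for c R r
    proof -
      have "\<And>i. i \<in> term_vars t \<Longrightarrow> i = 0 \<or> i \<in> {1..n}" using vars by fastforce
      then have "(r(0 := c)) i \<in> carrier A \<and> (R(0 := \<theta> `` {c})) i = \<theta> `` {(r(0 := c)) i}"
        if "i \<in> term_vars t" for i
        using that \<open>c \<in> carrier A\<close> \<open>\<And>i. i \<in> {1..n} \<Longrightarrow> r i \<in> carrier A \<and> R i = \<theta> `` {r i}\<close>
        by fastforce
      then show ?thesis
        using term_op_quot_alg[OF \<theta>, of t "r(0 := c)" "R(0 := \<theta> `` {c})"]
          term_op_closed[OF \<theta>, of t "r(0 := c)"] by simp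
    qed
    note ua = *[OF mem(1), of u U, OF uv(1)] and va = *[OF mem(1), of v V, OF uv(2)]
      and ub = *[OF mem(2), of u U, OF uv(1)] and vb = *[OF mem(2), of v V, OF uv(2)]
    have "\<theta> `` {term_op A t (u(0 := a))} = \<theta> `` {term_op A t (v(0 := a))}"
      using eq ua va unfolding X by (auto simp: zero_cong_def)
    then have "(term_op A t (u(0 := a)), term_op A t (v(0 := a))) \<in> \<theta>"
      using ua va congruence_class_eq_iff[OF \<theta>] by blast
    moreover have "\<forall>i\<in>{1..n}. (u i, v i) \<in> one_cong A" using uv by (auto simp: one_cong_def)
    ultimately have "(term_op A t (u(0 := b)), term_op A t (v(0 := b))) \<in> \<theta>"
      using cent vars ab unfolding centralizes_def by blast
    then have "\<theta> `` {term_op A t (u(0 := b))} = \<theta> `` {term_op A t (v(0 := b))}"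
      using ub vb congruence_class_eq_iff[OF \<theta>] by blast
    then show "(term_op (quot_alg A \<theta>) t (U(0 := Y)), term_op (quot_alg A \<theta>) t (V(0 := Y)))
        \<in> zero_cong (quot_alg A \<theta>)"
      using ub vb unfolding Y by (auto simp: zero_cong_def quot_alg_def intro: quotientI)
  qed
  with congruence_quot_cong[OF \<theta> \<alpha> sub] show ?thesis by (simp add: central_def)
qed

section \<open>Displacements\<close>

text \<open>
  Displacements are represented by words: the list of pairs \<open>(x, z)\<close> stands for the product of
  the permutations \<open>L\<^sub>x L\<^sub>z\<^sup>-\<^sup>1\<close>. Composition, inversion and conjugation become operations on
  lists, and no convention is needed for the values of maps outside the carrier.
\<close>

fun displace :: "'a binary_algebra \<Rightarrow> ('a \<times> 'a) list \<Rightarrow> 'a \<Rightarrow> 'a" where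
  "displace Q [] y = y"
| "displace Q ((x, z) # ps) y = x \<star>\<^bsub>Q\<^esub> (z \<setminus>\<^bsub>Q\<^esub> displace Q ps y)"

definition displacements :: "'a binary_algebra \<Rightarrow> ('a \<times> 'a) list set" where
  "displacements Q = lists (carrier Q \<times> carrier Q)"

definition inverse_word :: "('a \<times> 'a) list \<Rightarrow> ('a \<times> 'a) list" where
  "inverse_word ps = rev (map prod.swap ps)"

definition displacement_cong :: "'a binary_algebra \<Rightarrow> ('a \<times> 'a) set" where
  "displacement_cong Q =
     {(a, b). a \<in> carrier Q \<and> (\<exists>ps \<in> displacements Q. b = displace Q ps a)}"

lemma displace_append: "displace Q (ps @ qs) y = displace Q ps (displace Q qs y)"
  by (induction ps) auto

lemma displacements_Nil [simp]: "[] \<in> displacements Q"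
  by (simp add: displacements_def)

lemma displacements_Cons [simp]:
  "p # ps \<in> displacements Q \<longleftrightarrow> fst p \<in> carrier Q \<and> snd p \<in> carrier Q \<and> ps \<in> displacements Q"
  by (auto simp: displacements_def mem_Times_iff)

lemma displacements_append [simp]:
  "ps @ qs \<in> displacements Q \<longleftrightarrow> ps \<in> displacements Q \<and> qs \<in> displacements Q"
  by (auto simp: displacements_def)

lemma inverse_word_displacements: "ps \<in> displacements Q \<Longrightarrow> inverse_word ps \<in> displacements Q"
  by (auto simp: inverse_word_def displacements_def)

lemma map_displacements:
  "ps \<in> displacements Q \<Longrightarrow> (\<And>x. x \<in> carrier Q \<Longrightarrow> f x \<in> carrier Q) \<Longrightarrow>
    map (map_prod f f) ps \<in> displacements Q"
  by (fastforce simp: displacements_def mem_Times_iff)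

context rack
begin

lemmas closed [simp] = mult_closed ldiv_closed
lemmas cancel [simp] = ldiv_mult mult_ldiv

lemma mult_left_cancel:
  "\<lbrakk>c \<in> carrier Q; x \<in> carrier Q; y \<in> carrier Q\<rbrakk> \<Longrightarrow> c \<star> x = c \<star> y \<longleftrightarrow> x = y"
  by (metis ldiv_mult)

lemma mult_of_ldiv:
  assumes "x \<in> carrier Q" "y \<in> carrier Q" "z \<in> carrier Q"
  shows "x \<star> (y \<setminus> z) = (x \<star> y) \<setminus> (x \<star> z)"
proof -
  have "(x \<star> y) \<star> (x \<star> (y \<setminus> z)) = x \<star> z"
    using assms left_distrib[of x y "y \<setminus> z"] by simp
  then show ?thesis using assms ldiv_mult[of "x \<star> y" "x \<star> (y \<setminus> z)"] by simp
qed

lemma ldiv_of_mult: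
  assumes "x \<in> carrier Q" "y \<in> carrier Q" "z \<in> carrier Q"
  shows "x \<setminus> (y \<star> z) = (x \<setminus> y) \<star> (x \<setminus> z)"
proof -
  have "x \<star> ((x \<setminus> y) \<star> (x \<setminus> z)) = y \<star> z"
    using assms left_distrib[of x "x \<setminus> y" "x \<setminus> z"] by simp
  then show ?thesis using assms ldiv_mult[of x "(x \<setminus> y) \<star> (x \<setminus> z)"] by simp
qed

lemma displace_closed [simp]:
  "ps \<in> displacements Q \<Longrightarrow> y \<in> carrier Q \<Longrightarrow> displace Q ps y \<in> carrier Q"
  by (induction ps) auto

lemma displace_inverse_word_left:
  assumes "ps \<in> displacements Q" "y \<in> carrier Q"
  shows "displace Q (inverse_word ps) (displace Q ps y) = y"
  using assms
proof (induction ps arbitrary: y)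
  case (Cons p ps)
  obtain x z where "p = (x, z)" by force
  with Cons show ?case by (auto simp: inverse_word_def displace_append)
qed (simp add: inverse_word_def)

lemma displace_inverse_word_right:
  assumes "ps \<in> displacements Q" "y \<in> carrier Q"
  shows "displace Q ps (displace Q (inverse_word ps) y) = y"
proof -
  have "inverse_word (inverse_word ps) = ps"
    by (simp add: inverse_word_def rev_map comp_def)
  then show ?thesis
    using displace_inverse_word_left[OF inverse_word_displacements[OF assms(1)] assms(2)] by simp
qed

lemma displace_mult:
  assumes "ps \<in> displacements Q" "x \<in> carrier Q" "y \<in> carrier Q"
  shows "displace Q ps (x \<star> y) = displace Q ps x \<star> displace Q ps y"
  using assms
proof (induction ps)
  case (Cons p ps)
  obtain u v where p: "p = (u, v)" by force
  with Cons show ?case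
    using left_distrib[of u "v \<setminus> displace Q ps x" "v \<setminus> displace Q ps y"]
    by (simp add: ldiv_of_mult)
qed simp

lemma displace_ldiv:
  assumes "ps \<in> displacements Q" "x \<in> carrier Q" "y \<in> carrier Q"
  shows "displace Q ps (x \<setminus> y) = displace Q ps x \<setminus> displace Q ps y"
proof -
  have "displace Q ps x \<star> displace Q ps (x \<setminus> y) = displace Q ps y"
    using assms displace_mult[of ps x "x \<setminus> y"] by simp
  then show ?thesis
    using assms ldiv_mult[of "displace Q ps x" "displace Q ps (x \<setminus> y)"] by simp
qed

text \<open>
  Since \<open>L\<^sub>c\<close> is an automorphism, it conjugates \<open>L\<^sub>x L\<^sub>z\<^sup>-\<^sup>1\<close> to the displacement given by the
  images of \<open>x\<close> and \<open>z\<close>.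
\<close>

lemma mult_displace:
  assumes "ps \<in> displacements Q" "c \<in> carrier Q" "y \<in> carrier Q"
  shows "c \<star> displace Q ps y = displace Q (map (map_prod ((\<star>) c) ((\<star>) c)) ps) (c \<star> y)"
  using assms
proof (induction ps)
  case (Cons p ps)
  obtain x z where p: "p = (x, z)" by force
  define d where "d = displace Q ps y"
  have mem: "x \<in> carrier Q" "z \<in> carrier Q" "d \<in> carrier Q" "ps \<in> displacements Q"
    using Cons.prems p by (auto simp: d_def)
  have "c \<star> (x \<star> (z \<setminus> d)) = (c \<star> x) \<star> ((c \<star> z) \<setminus> (c \<star> d))"
    using mem \<open>c \<in> carrier Q\<close> left_distrib[of c x "z \<setminus> d"] mult_of_ldiv[of c z d] by simp
  moreover have "c \<star> d = displace Q (map (map_prod ((\<star>) c) ((\<star>) c)) ps) (c \<star> y)"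
    using Cons mem by (simp add: d_def)
  ultimately show ?case using p by (simp add: d_def)
qed simp

end

section \<open>The displacement group of a medial rack\<close>

context medial_rack
begin

text \<open>
  Expanding \<open>L\<^bsub>x \<star> y\<^esub> = L\<^sub>x L\<^sub>y L\<^sub>x\<^sup>-\<^sup>1\<close> turns the medial law \<open>L\<^bsub>x \<star> y\<^esub> L\<^sub>u = L\<^bsub>x \<star> u\<^esub> L\<^sub>y\<close> into
  this symmetry.
\<close>

lemma translation_swap:
  assumes "x \<in> carrier Q" "y \<in> carrier Q" "u \<in> carrier Q" "w \<in> carrier Q"
  shows "y \<star> (x \<setminus> (u \<star> w)) = u \<star> (x \<setminus> (y \<star> w))"
proof -
  have exp: "(x \<star> p) \<star> q = x \<star> (p \<star> (x \<setminus> q))" if "p \<in> carrier Q" "q \<in> carrier Q" for p q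
    using left_distrib[of x p "x \<setminus> q"] assms that by simp
  have "x \<star> (y \<star> (x \<setminus> (u \<star> w))) = x \<star> (u \<star> (x \<setminus> (y \<star> w)))"
    using medial[of x y u w] assms by (simp add: exp)
  then show ?thesis using assms by (simp add: mult_left_cancel)
qed

text \<open>The inverse form of the previous identity, obtained by substituting \<open>w = y \<setminus> (x \<star> (u \<setminus> w'))\<close>.\<close>

lemma translation_swap_inverse:
  assumes "x \<in> carrier Q" "y \<in> carrier Q" "u \<in> carrier Q" "w \<in> carrier Q"
  shows "y \<setminus> (x \<star> (u \<setminus> w)) = u \<setminus> (x \<star> (y \<setminus> w))"
proof -
  have "u \<star> (x \<setminus> (y \<star> (y \<setminus> (x \<star> (u \<setminus> w))))) = w" using assms by simp
  then have "y \<star> (x \<setminus> (u \<star> (y \<setminus> (x \<star> (u \<setminus> w))))) = w"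
    using assms translation_swap[of x u y "y \<setminus> (x \<star> (u \<setminus> w))"] by simp
  then have "u \<star> (y \<setminus> (x \<star> (u \<setminus> w))) = x \<star> (y \<setminus> w)"
    using assms by (metis closed cancel)
  then show ?thesis using assms by (metis closed cancel)
qed

lemma displace_pair_commute:
  assumes "x \<in> carrier Q" "z \<in> carrier Q" "x' \<in> carrier Q" "z' \<in> carrier Q" "y \<in> carrier Q"
  shows "x \<star> (z \<setminus> (x' \<star> (z' \<setminus> y))) = x' \<star> (z' \<setminus> (x \<star> (z \<setminus> y)))"
  using assms translation_swap[of z x x' "z' \<setminus> y"] translation_swap_inverse[of x z z' y] by simp

lemma displace_commute:
  assumes "ps \<in> displacements Q" "qs \<in> displacements Q" "y \<in> carrier Q"
  shows "displace Q ps (displace Q qs y) = displace Q qs (displace Q ps y)"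
proof -
  have pair: "x \<star> (z \<setminus> displace Q qs w) = displace Q qs (x \<star> (z \<setminus> w))"
    if "x \<in> carrier Q" "z \<in> carrier Q" "w \<in> carrier Q" for x z w
    using assms(2)
  proof (induction qs)
    case (Cons q qs)
    obtain x' z' where "q = (x', z')" by force
    with Cons that show ?case
      by (auto simp: displace_pair_commute[of x z x' z'])
  qed simp
  show ?thesis using assms(1)
    by (induction ps) (use assms in \<open>auto simp: pair\<close>)
qed

text \<open>
  A single displacement serves as the conjugate for all left translations, because \<open>L\<^sub>s L\<^sub>c\<^sup>-\<^sup>1\<close> is
  itself a displacement and commutes with the conjugate by \<open>L\<^sub>c\<close>.
\<close>

lemma uniform_conjugate:
  assumes "ps \<in> displacements Q"
  shows "\<exists>qs \<in> displacements Q. \<forall>s \<in> carrier Q. \<forall>y \<in> carrier Q.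
    s \<star> displace Q ps y = displace Q qs (s \<star> y)"
proof -
  obtain c where c: "c \<in> carrier Q" using nonempty by blast
  define qs where "qs = map (map_prod ((\<star>) c) ((\<star>) c)) ps"
  have qs: "qs \<in> displacements Q"
    unfolding qs_def using assms c by (intro map_displacements) simp_all
  have "s \<star> displace Q ps y = displace Q qs (s \<star> y)" if "s \<in> carrier Q" "y \<in> carrier Q" for s y
  proof -
    have "s \<star> displace Q ps y = displace Q [(s, c)] (c \<star> displace Q ps y)"
      using assms that c by simp
    also have "\<dots> = displace Q [(s, c)] (displace Q qs (c \<star> y))"
      using assms that c mult_displace unfolding qs_def by simp
    also have "\<dots> = displace Q qs (displace Q [(s, c)] (c \<star> y))"
      using qs that c by (intro displace_commute) auto
    also have "\<dots> = displace Q qs (s \<star> y)" using that c by simp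
    finally show ?thesis .
  qed
  with qs show ?thesis by blast
qed

text \<open>
  Conjugation by \<open>L\<^sub>c\<close> maps the displacement group onto itself: \<open>ps\<close> is the conjugate of the word
  with all letters divided by \<open>c\<close>. So the uniform conjugation can be inverted.
\<close>

lemma uniform_conjugate_inverse:
  assumes "ps \<in> displacements Q"
  shows "\<exists>qs \<in> displacements Q. \<forall>s \<in> carrier Q. \<forall>y \<in> carrier Q.
    s \<setminus> displace Q ps y = displace Q qs (s \<setminus> y)"
proof -
  obtain c where c: "c \<in> carrier Q" using nonempty by blast
  define qs where "qs = map (map_prod ((\<setminus>) c) ((\<setminus>) c)) ps"
  have qs: "qs \<in> displacements Q"
    unfolding qs_def using assms c by (intro map_displacements) simp_all
  obtain rs where rs: "rs \<in> displacements Q"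
    "\<And>s y. s \<in> carrier Q \<Longrightarrow> y \<in> carrier Q \<Longrightarrow> s \<star> displace Q qs y = displace Q rs (s \<star> y)"
    using uniform_conjugate[OF qs] by blast
  have "map (map_prod ((\<star>) c) ((\<star>) c)) qs = ps"
    unfolding qs_def using assms c by (auto simp: displacements_def intro!: map_idI)
  then have "c \<star> displace Q qs y = displace Q ps (c \<star> y)" if "y \<in> carrier Q" for y
    using mult_displace[OF qs c that] by simp
  then have rs_eq: "displace Q rs y = displace Q ps y" if "y \<in> carrier Q" for y
    using rs(2)[of c "c \<setminus> y"] c that by simp
  have "s \<setminus> displace Q ps y = displace Q qs (s \<setminus> y)" if "s \<in> carrier Q" "y \<in> carrier Q" for s y
  proof -
    have "s \<star> displace Q qs (s \<setminus> y) = displace Q ps y"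
      using rs(2)[of s "s \<setminus> y"] rs_eq that by simp
    then show ?thesis using that qs ldiv_mult[of s "displace Q qs (s \<setminus> y)"] by simp
  qed
  with qs show ?thesis by blast
qed

text \<open>
  For displacements \<open>g\<close>, \<open>h\<close> one has \<open>g x \<star> h y = g (x \<star> g\<^sup>-\<^sup>1 h y)\<close>, and \<open>g\<^sup>-\<^sup>1 h\<close> can be moved past
  \<open>L\<^sub>x\<close> independently of \<open>x\<close>. The independence of \<open>x\<close> and \<open>y\<close> gives centrality; the mere
  existence makes the orbit relation a congruence.
\<close>

lemma displace_mult_displace:
  assumes "ps \<in> displacements Q" "qs \<in> displacements Q"
  shows "\<exists>rs \<in> displacements Q. \<forall>x \<in> carrier Q. \<forall>y \<in> carrier Q.
    displace Q ps x \<star> displace Q qs y = displace Q rs (x \<star> y)"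
proof -
  have w: "inverse_word ps @ qs \<in> displacements Q"
    using assms inverse_word_displacements[of ps] by simp
  obtain rs where rs: "rs \<in> displacements Q" "\<And>s y. s \<in> carrier Q \<Longrightarrow> y \<in> carrier Q \<Longrightarrow>
      s \<star> displace Q (inverse_word ps @ qs) y = displace Q rs (s \<star> y)"
    using uniform_conjugate[OF w] by blast
  have "displace Q ps x \<star> displace Q qs y = displace Q (ps @ rs) (x \<star> y)"
    if "x \<in> carrier Q" "y \<in> carrier Q" for x y
    using that assms displace_mult[OF assms(1), of x "displace Q (inverse_word ps @ qs) y"]
      displace_closed[OF w] rs(2)[of x y]
    by (simp add: displace_append displace_inverse_word_right)
  moreover have "ps @ rs \<in> displacements Q" using assms rs by simp
  ultimately show ?thesis by blast
qed

lemma displace_ldiv_displace: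
  assumes "ps \<in> displacements Q" "qs \<in> displacements Q"
  shows "\<exists>rs \<in> displacements Q. \<forall>x \<in> carrier Q. \<forall>y \<in> carrier Q.
    displace Q ps x \<setminus> displace Q qs y = displace Q rs (x \<setminus> y)"
proof -
  have w: "inverse_word ps @ qs \<in> displacements Q"
    using assms inverse_word_displacements[of ps] by simp
  obtain rs where rs: "rs \<in> displacements Q" "\<And>s y. s \<in> carrier Q \<Longrightarrow> y \<in> carrier Q \<Longrightarrow>
      s \<setminus> displace Q (inverse_word ps @ qs) y = displace Q rs (s \<setminus> y)"
    using uniform_conjugate_inverse[OF w] by blast
  have "displace Q ps x \<setminus> displace Q qs y = displace Q (ps @ rs) (x \<setminus> y)"
    if "x \<in> carrier Q" "y \<in> carrier Q" for x y
    using that assms displace_ldiv[OF assms(1), of x "displace Q (inverse_word ps @ qs) y"]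
      displace_closed[OF w] rs(2)[of x y]
    by (simp add: displace_append displace_inverse_word_right)
  moreover have "ps @ rs \<in> displacements Q" using assms rs by simp
  ultimately show ?thesis by blast
qed

section \<open>The central chain\<close>

lemma congruence_displacement_cong: "congruence Q (displacement_cong Q)"
proof -
  have "equiv (carrier Q) (displacement_cong Q)"
  proof (rule equivI)
    show "displacement_cong Q \<subseteq> carrier Q \<times> carrier Q"
      by (auto simp: displacement_cong_def)
    show "refl_on (carrier Q) (displacement_cong Q)"
      by (auto simp: refl_on_def displacement_cong_def intro!: bexI[of _ "[]"])
    show "sym (displacement_cong Q)"
    proof (rule symI)
      fix a b assume "(a, b) \<in> displacement_cong Q"
      then obtain ps where "a \<in> carrier Q" "ps \<in> displacements Q" "b = displace Q ps a"
        by (auto simp: displacement_cong_def)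
      then show "(b, a) \<in> displacement_cong Q"
        using displace_inverse_word_left[of ps a] inverse_word_displacements[of ps]
        unfolding displacement_cong_def by force
    qed
    show "trans (displacement_cong Q)"
    proof (rule transI)
      fix a b c assume "(a, b) \<in> displacement_cong Q" "(b, c) \<in> displacement_cong Q"
      then obtain ps qs where "a \<in> carrier Q" "ps \<in> displacements Q" "qs \<in> displacements Q"
          "c = displace Q (qs @ ps) a"
        by (auto simp: displacement_cong_def displace_append)
      moreover from this have "qs @ ps \<in> displacements Q" by simp
      ultimately show "(a, c) \<in> displacement_cong Q"
        unfolding displacement_cong_def by blast
    qed
  qed
  moreover have "(x \<star> y, x' \<star> y') \<in> displacement_cong Q \<and> (x \<setminus> y, x' \<setminus> y') \<in> displacement_cong Q"
    if rel: "(x, x') \<in> displacement_cong Q" "(y, y') \<in> displacement_cong Q" for x x' y y'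
  proof -
    obtain ps where x: "x \<in> carrier Q" "ps \<in> displacements Q" "x' = displace Q ps x"
      using rel(1) by (auto simp: displacement_cong_def)
    obtain qs where y: "y \<in> carrier Q" "qs \<in> displacements Q" "y' = displace Q qs y"
      using rel(2) by (auto simp: displacement_cong_def)
    show ?thesis
      using x y displace_mult_displace[of ps qs] displace_ldiv_displace[of ps qs]
      unfolding displacement_cong_def by fastforce
  qed
  ultimately show ?thesis by (simp add: congruence_def)
qed

text \<open>
  The displacement is chosen before the assignment \<open>\<rho>\<close> of the other variables, which is the
  whole point: this uniformity makes the orbit congruence central.
\<close>

lemma term_op_displace:
  assumes "ps \<in> displacements Q" "a \<in> carrier Q"
  shows "\<exists>qs \<in> displacements Q. \<forall>\<rho>. (\<forall>i \<in> term_vars t - {0}. \<rho> i \<in> carrier Q) \<longrightarrow>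
    term_op Q t (\<rho>(0 := displace Q ps a)) = displace Q qs (term_op Q t (\<rho>(0 := a)))"
proof (induction t)
  case (Var i)
  show ?case
  proof (cases "i = 0")
    case True
    then show ?thesis using assms by auto
  next
    case False
    then show ?thesis by (auto intro!: bexI[of _ "[]"])
  qed
next
  case (Mult s t)
  obtain qs where qs: "qs \<in> displacements Q" "\<And>\<rho>. \<forall>i \<in> term_vars s - {0}. \<rho> i \<in> carrier Q \<Longrightarrow>
      term_op Q s (\<rho>(0 := displace Q ps a)) = displace Q qs (term_op Q s (\<rho>(0 := a)))"
    using Mult.IH(1) by blast
  obtain rs where rs: "rs \<in> displacements Q" "\<And>\<rho>. \<forall>i \<in> term_vars t - {0}. \<rho> i \<in> carrier Q \<Longrightarrow>
      term_op Q t (\<rho>(0 := displace Q ps a)) = displace Q rs (term_op Q t (\<rho>(0 := a)))"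
    using Mult.IH(2) by blast
  obtain ws where ws: "ws \<in> displacements Q" "\<And>x y. x \<in> carrier Q \<Longrightarrow> y \<in> carrier Q \<Longrightarrow>
      displace Q qs x \<star> displace Q rs y = displace Q ws (x \<star> y)"
    using displace_mult_displace[OF qs(1) rs(1)] by blast
  have "term_op Q (Mult s t) (\<rho>(0 := displace Q ps a))
      = displace Q ws (term_op Q (Mult s t) (\<rho>(0 := a)))"
    if "\<forall>i \<in> term_vars (Mult s t) - {0}. \<rho> i \<in> carrier Q" for \<rho>
  proof -
    have "term_op Q s (\<rho>(0 := a)) \<in> carrier Q" "term_op Q t (\<rho>(0 := a)) \<in> carrier Q"
      using that assms by (auto intro!: term_op_closed[OF congruence_displacement_cong])
    then show ?thesis using qs(2)[of \<rho>] rs(2)[of \<rho>] ws(2) that by simp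
  qed
  with ws(1) show ?case by blast
next
  case (LDiv s t)
  obtain qs where qs: "qs \<in> displacements Q" "\<And>\<rho>. \<forall>i \<in> term_vars s - {0}. \<rho> i \<in> carrier Q \<Longrightarrow>
      term_op Q s (\<rho>(0 := displace Q ps a)) = displace Q qs (term_op Q s (\<rho>(0 := a)))"
    using LDiv.IH(1) by blast
  obtain rs where rs: "rs \<in> displacements Q" "\<And>\<rho>. \<forall>i \<in> term_vars t - {0}. \<rho> i \<in> carrier Q \<Longrightarrow>
      term_op Q t (\<rho>(0 := displace Q ps a)) = displace Q rs (term_op Q t (\<rho>(0 := a)))"
    using LDiv.IH(2) by blast
  obtain ws where ws: "ws \<in> displacements Q" "\<And>x y. x \<in> carrier Q \<Longrightarrow> y \<in> carrier Q \<Longrightarrow>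
      displace Q qs x \<setminus> displace Q rs y = displace Q ws (x \<setminus> y)"
    using displace_ldiv_displace[OF qs(1) rs(1)] by blast
  have "term_op Q (LDiv s t) (\<rho>(0 := displace Q ps a))
      = displace Q ws (term_op Q (LDiv s t) (\<rho>(0 := a)))"
    if "\<forall>i \<in> term_vars (LDiv s t) - {0}. \<rho> i \<in> carrier Q" for \<rho>
  proof -
    have "term_op Q s (\<rho>(0 := a)) \<in> carrier Q" "term_op Q t (\<rho>(0 := a)) \<in> carrier Q"
      using that assms by (auto intro!: term_op_closed[OF congruence_displacement_cong])
    then show ?thesis using qs(2)[of \<rho>] rs(2)[of \<rho>] ws(2) that by simp
  qed
  with ws(1) show ?case by blast
qed

lemma centralizes_displacement_cong:
  "centralizes Q (displacement_cong Q) (one_cong Q) (zero_cong Q)"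
  unfolding centralizes_def
proof (intro allI impI)
  fix n t a b u v
  assume vars: "term_vars t \<subseteq> {0..n}" and ab: "(a, b) \<in> displacement_cong Q"
    and uv: "\<forall>i\<in>{1..n}. (u i, v i) \<in> one_cong Q"
    and eq: "(term_op Q t (u(0 := a)), term_op Q t (v(0 := a))) \<in> zero_cong Q"
  from ab obtain ps where a: "a \<in> carrier Q" and ps: "ps \<in> displacements Q"
    and b: "b = displace Q ps a"
    by (auto simp: displacement_cong_def)
  have "\<forall>i \<in> term_vars t - {0}. i \<in> {1..n}" using vars by fastforce
  then have mem: "\<forall>i \<in> term_vars t - {0}. u i \<in> carrier Q" "\<forall>i \<in> term_vars t - {0}. v i \<in> carrier Q"
    using uv by (auto simp: one_cong_def)
  obtain qs where "qs \<in> displacements Q"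
    "\<And>\<rho>. \<forall>i \<in> term_vars t - {0}. \<rho> i \<in> carrier Q \<Longrightarrow>
      term_op Q t (\<rho>(0 := b)) = displace Q qs (term_op Q t (\<rho>(0 := a)))"
    using term_op_displace[OF ps a, of t] unfolding b by blast
  then show "(term_op Q t (u(0 := b)), term_op Q t (v(0 := b))) \<in> zero_cong Q"
    using eq mem by (auto simp: zero_cong_def)
qed

text \<open>
  The displacement \<open>L\<^bsub>x'\<^esub> L\<^sub>x\<^sup>-\<^sup>1\<close> maps \<open>x \<star> y'\<close> to \<open>x' \<star> y'\<close>, so modulo displacements all left
  translations agree; each of them is injective modulo the congruence because left division
  respects it.
\<close>

lemma displacement_cong_mult_iff:
  assumes "x \<in> carrier Q" "x' \<in> carrier Q" "y \<in> carrier Q" "y' \<in> carrier Q"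
  shows "(x \<star> y, x' \<star> y') \<in> displacement_cong Q \<longleftrightarrow> (y, y') \<in> displacement_cong Q"
proof -
  note C = congruence_displacement_cong
  have "(x \<star> y', x' \<star> y') \<in> displacement_cong Q"
    unfolding displacement_cong_def using assms
    by (auto intro!: bexI[of _ "[(x', x)]"])
  then have "(x \<star> y, x' \<star> y') \<in> displacement_cong Q \<longleftrightarrow> (x \<star> y, x \<star> y') \<in> displacement_cong Q"
    using congruence_trans[OF C] congruence_sym[OF C] by blast
  also have "\<dots> \<longleftrightarrow> (y, y') \<in> displacement_cong Q"
    using congruence_mult[OF C congruence_refl[OF C], of x y y']
      congruence_ldiv[OF C congruence_refl[OF C], of x "x \<star> y" "x \<star> y'"] assms by auto
  finally show ?thesis .
qed

lemma displacement_cong_ldiv_iff: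
  assumes "x \<in> carrier Q" "x' \<in> carrier Q" "y \<in> carrier Q" "y' \<in> carrier Q"
  shows "(x \<setminus> y, x' \<setminus> y') \<in> displacement_cong Q \<longleftrightarrow> (y, y') \<in> displacement_cong Q"
  using displacement_cong_mult_iff[of x x' "x \<setminus> y" "x' \<setminus> y'"] assms by simp

text \<open>The variable \<open>r\<close> is the rightmost variable of the term.\<close>

lemma term_op_rightmost:
  "\<exists>r \<in> term_vars t. \<forall>\<rho> \<sigma>. (\<forall>i \<in> term_vars t. \<rho> i \<in> carrier Q \<and> \<sigma> i \<in> carrier Q) \<longrightarrow>
    (term_op Q t \<rho>, term_op Q t \<sigma>) \<in> displacement_cong Q \<longleftrightarrow> (\<rho> r, \<sigma> r) \<in> displacement_cong Q"
proof (induction t)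
  case (Mult s t)
  note cl = term_op_closed[OF congruence_displacement_cong]
  from Mult.IH(2) show ?case by (auto simp: displacement_cong_mult_iff cl)
next
  case (LDiv s t)
  note cl = term_op_closed[OF congruence_displacement_cong]
  from LDiv.IH(2) show ?case by (auto simp: displacement_cong_ldiv_iff cl)
qed simp

lemma centralizes_modulo_displacement_cong:
  "centralizes Q (one_cong Q) (one_cong Q) (displacement_cong Q)"
  unfolding centralizes_def
proof (intro allI impI)
  fix n t a b u v
  assume vars: "term_vars t \<subseteq> {0..n}" and ab: "(a, b) \<in> one_cong Q"
    and uv: "\<forall>i\<in>{1..n}. (u i, v i) \<in> one_cong Q"
    and rel: "(term_op Q t (u(0 := a)), term_op Q t (v(0 := a))) \<in> displacement_cong Q"
  obtain r where r: "\<And>\<rho> \<sigma>. \<forall>i \<in> term_vars t. \<rho> i \<in> carrier Q \<and> \<sigma> i \<in> carrier Q \<Longrightarrow>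
      (term_op Q t \<rho>, term_op Q t \<sigma>) \<in> displacement_cong Q \<longleftrightarrow> (\<rho> r, \<sigma> r) \<in> displacement_cong Q"
    using term_op_rightmost[of t] by blast
  have "\<forall>i \<in> term_vars t. i = 0 \<or> i \<in> {1..n}" using vars by fastforce
  then have mem: "\<forall>i \<in> term_vars t. (u(0 := c)) i \<in> carrier Q \<and> (v(0 := c)) i \<in> carrier Q"
    if "c \<in> carrier Q" for c
    using uv that by (auto simp: one_cong_def)
  have "a \<in> carrier Q" "b \<in> carrier Q" using ab by (auto simp: one_cong_def)
  then show "(term_op Q t (u(0 := b)), term_op Q t (v(0 := b))) \<in> displacement_cong Q"
    using rel r[of "u(0 := a)" "v(0 := a)"] r[of "u(0 := b)" "v(0 := b)"] mem[of a] mem[of b]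
      congruence_refl[OF congruence_displacement_cong, of b]
    by (cases "r = 0") (simp_all del: fun_upd_apply add: fun_upd_same fun_upd_other)
qed

lemma central_chain_displacement_cong:
  "central_chain Q 2 (\<lambda>i. if i = 0 then zero_cong Q else if i = 1 then displacement_cong Q else one_cong Q)"
proof -
  have zero: "congruence Q (zero_cong Q)"
    by (auto simp: congruence_def zero_cong_def equiv_def refl_on_def sym_def trans_def)
  have one: "congruence Q (one_cong Q)"
    by (auto simp: congruence_def one_cong_def equiv_def refl_on_def sym_def trans_def)
  note disp = congruence_displacement_cong
  have sub: "zero_cong Q \<subseteq> displacement_cong Q" "displacement_cong Q \<subseteq> one_cong Q"
    using congruence_refl[OF disp] congruence_subset[OF disp]
    by (auto simp: zero_cong_def one_cong_def)
  show ?thesis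
    using zero one disp sub
      central_quot_cong[OF zero disp sub(1) centralizes_displacement_cong]
      central_quot_cong[OF disp one sub(2) centralizes_modulo_displacement_cong]
    by (auto simp: central_chain_def less_2_cases_iff)
qed

end

theorem proposition5p13:
  fixes Q :: "'a binary_algebra"
  assumes "medial_rack Q"
  shows "nilpotent Q \<and> nilpotence_length Q \<le> 2"
proof -
  interpret medial_rack Q by (fact assms)
  have "\<exists>\<alpha>. central_chain Q 2 \<alpha>" using central_chain_displacement_cong by blast
  then show ?thesis
    unfolding nilpotent_def nilpotence_length_def by (blast intro: Least_le)
qed

end
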